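(* Let $H$ be a Hilbert space. A connection on $B(H)^+$ is a mean if and only if its associated measure is a probability measure.
   Context: $B(H)$ is the algebra of bounded linear operators on the Hilbert space $H$ and $B(H)^+$ is the set of positive (i.e. positive semidefinite) operators. For Hermitian $A,B$, $A\le B$ means $B-A\in B(H)^+$. A connection is a binary operation $\sigma$ on $B(H)^+$ such that for all $A,B,C,D\in B(H)^+$: (M1) $A\le C$, $B\le D$ implies $A\,\sigma\,B\le C\,\sigma\,D$; (M2) $C(A\,\sigma\,B)C\le (CAC)\,\sigma\,(CBC)$; (M3) for $A_n,B_n\in B(H)^+$, if $A_n\downarrow A$ and $B_n\downarrow B$ then $A_n\,\sigma\,B_n\downarrow A\,\sigma\,B$, where $A_n\downarrow A$ means that $(A_n)$ is a decreasing sequence converging strongly to $A$. A mean is a connection $\sigma$ with $I\,\sigma\,I=I$. For $t\in[0,1]$, the $t$-weighted harmonic mean is $A\,!_t\,B=[(1-t)A^{-1}+tB^{-1}]^{-1}$ for invertible positive $A,B$, extended to all $A,B\in B(H)^+$ as the strong limit of $(A+\varepsilon I)\,!_t\,(B+\varepsilon I)$ as $\varepsilon\downarrow 0$; thus $A\,!_0\,B=A$ and $A\,!_1\,B=B$. Operator-valued integrals are Bochner integrals. Every connection $\sigma$ has the form $A\,\sigma\,B=\int_{[0,1]}A\,!_t\,B\,d\mu(t)$ ($A,B\in B(H)^+$) for a unique finite Borel measure $\mu$ on $[0,1]$; this $\mu$ is called the associated measure of $\sigma$. *)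

theory Defs
  imports "HOL-Probability.Probability"
begin

section \<open>Complex Hilbert spaces and positive operators\<close>

text \<open>
  A complex Hilbert space: a real Banach space with a compatible complex scalar multiplication
  and a complex inner product, linear in its first argument, that induces the norm. The last
  axiom contains positive definiteness, as \<open>norm x = 0\<close> holds only for \<open>x = 0\<close>.
\<close>

class complex_hilbert = banach +
  fixes scaleC :: "complex \<Rightarrow> 'a \<Rightarrow> 'a"  (infixr \<open>*\<^sub>C\<close> 75)
    and cinner :: "'a \<Rightarrow> 'a \<Rightarrow> complex"
  assumes scaleC_add_right: "c *\<^sub>C (x + y) = c *\<^sub>C x + c *\<^sub>C y"
    and scaleC_add_left: "(c + d) *\<^sub>C x = c *\<^sub>C x + d *\<^sub>C x"
    and scaleC_scaleC: "c *\<^sub>C (d *\<^sub>C x) = (c * d) *\<^sub>C x"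
    and scaleC_of_real: "complex_of_real r *\<^sub>C x = r *\<^sub>R x"
    and cinner_add_left: "cinner (x + y) z = cinner x z + cinner y z"
    and cinner_scaleC_left: "cinner (c *\<^sub>C x) y = c * cinner x y"
    and cinner_commute: "cinner x y = cnj (cinner y x)"
    and cinner_self: "cinner x x = complex_of_real ((norm x)\<^sup>2)"

text \<open>
  The type \<open>'h \<Rightarrow>\<^sub>L 'h\<close> consists of the bounded real-linear operators, with the operator norm.
  The complex-linear ones form \<open>B(H)\<close>, a norm-closed subspace.
\<close>

definition bounded_operators :: "('h::complex_hilbert \<Rightarrow>\<^sub>L 'h) set"  (\<open>BH\<close>)
  where "BH = {A. \<forall>c x. blinfun_apply A (c *\<^sub>C x) = c *\<^sub>C blinfun_apply A x}"

text \<open>Over the complex numbers, a nonnegative quadratic form forces \<open>A\<close> to be Hermitian.\<close>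

definition positive_operators :: "('h::complex_hilbert \<Rightarrow>\<^sub>L 'h) set"  (\<open>BHpos\<close>)
  where "BHpos = {A \<in> BH. \<forall>x. cinner (blinfun_apply A x) x \<in> \<real>\<^sub>\<ge>\<^sub>0}"

definition op_le :: "('h::complex_hilbert \<Rightarrow>\<^sub>L 'h) \<Rightarrow> ('h \<Rightarrow>\<^sub>L 'h) \<Rightarrow> bool"  (infix \<open>\<sqsubseteq>\<close> 50)
  where "A \<sqsubseteq> B \<longleftrightarrow> B - A \<in> BHpos"

definition strong_limit ::
    "('i \<Rightarrow> ('h::complex_hilbert \<Rightarrow>\<^sub>L 'h)) \<Rightarrow> ('h \<Rightarrow>\<^sub>L 'h) \<Rightarrow> 'i filter \<Rightarrow> bool"
  where "strong_limit X A F \<longleftrightarrow>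
    (\<forall>x. ((\<lambda>i. blinfun_apply (X i) x) \<longlongrightarrow> blinfun_apply A x) F)"

definition decreases_to ::
    "(nat \<Rightarrow> ('h::complex_hilbert \<Rightarrow>\<^sub>L 'h)) \<Rightarrow> ('h \<Rightarrow>\<^sub>L 'h) \<Rightarrow> bool"  (infix \<open>\<down>\<close> 50)
  where "X \<down> A \<longleftrightarrow> (\<forall>n. X (Suc n) \<sqsubseteq> X n) \<and> strong_limit X A sequentially"


section \<open>Connections and means\<close>

text \<open>
  A binary operation on \<open>B(H)\<^sup>+\<close> is a total function whose values off \<open>B(H)\<^sup>+\<close> are irrelevant.
\<close>

definition connection ::
    "(('h::complex_hilbert \<Rightarrow>\<^sub>L 'h) \<Rightarrow> ('h \<Rightarrow>\<^sub>L 'h) \<Rightarrow> ('h \<Rightarrow>\<^sub>L 'h)) \<Rightarrow> bool"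
  where "connection \<sigma> \<longleftrightarrow>
    (\<forall>A\<in>BHpos. \<forall>B\<in>BHpos. \<sigma> A B \<in> BHpos) \<and>
    (\<forall>A\<in>BHpos. \<forall>B\<in>BHpos. \<forall>C\<in>BHpos. \<forall>D\<in>BHpos.
      A \<sqsubseteq> C \<longrightarrow> B \<sqsubseteq> D \<longrightarrow> \<sigma> A B \<sqsubseteq> \<sigma> C D) \<and>
    (\<forall>A\<in>BHpos. \<forall>B\<in>BHpos. \<forall>C\<in>BHpos.
      C o\<^sub>L \<sigma> A B o\<^sub>L C \<sqsubseteq> \<sigma> (C o\<^sub>L A o\<^sub>L C) (C o\<^sub>L B o\<^sub>L C)) \<and>
    (\<forall>X Y. \<forall>A\<in>BHpos. \<forall>B\<in>BHpos.
      (\<forall>n. X n \<in> BHpos) \<longrightarrow> (\<forall>n. Y n \<in> BHpos) \<longrightarrow> X \<down> A \<longrightarrow> Y \<down> B \<longrightarrow>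
      (\<lambda>n. \<sigma> (X n) (Y n)) \<down> \<sigma> A B)"

definition mean ::
    "(('h::complex_hilbert \<Rightarrow>\<^sub>L 'h) \<Rightarrow> ('h \<Rightarrow>\<^sub>L 'h) \<Rightarrow> ('h \<Rightarrow>\<^sub>L 'h)) \<Rightarrow> bool"
  where "mean \<sigma> \<longleftrightarrow> connection \<sigma> \<and> \<sigma> id_blinfun id_blinfun = id_blinfun"


section \<open>Weighted harmonic means\<close>

text \<open>A two-sided inverse of an operator is unique; the value is unspecified if there is none.\<close>

definition op_inverse :: "('h::complex_hilbert \<Rightarrow>\<^sub>L 'h) \<Rightarrow> ('h \<Rightarrow>\<^sub>L 'h)"
  where "op_inverse A = (THE B. A o\<^sub>L B = id_blinfun \<and> B o\<^sub>L A = id_blinfun)"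

definition harmonic_inv ::
    "real \<Rightarrow> ('h::complex_hilbert \<Rightarrow>\<^sub>L 'h) \<Rightarrow> ('h \<Rightarrow>\<^sub>L 'h) \<Rightarrow> ('h \<Rightarrow>\<^sub>L 'h)"
  where "harmonic_inv t A B =
    op_inverse ((1 - t) *\<^sub>R op_inverse A + t *\<^sub>R op_inverse B)"

text \<open>
  On invertible positive operators the limit below agrees with \<open>harmonic_inv\<close>, since inversion
  is norm-continuous.
\<close>

definition harmonic_mean ::
    "real \<Rightarrow> ('h::complex_hilbert \<Rightarrow>\<^sub>L 'h) \<Rightarrow> ('h \<Rightarrow>\<^sub>L 'h) \<Rightarrow> ('h \<Rightarrow>\<^sub>L 'h)"
  where "harmonic_mean t A B =
    (THE C. strong_limit
       (\<lambda>\<epsilon>. harmonic_inv t (A + \<epsilon> *\<^sub>R id_blinfun) (B + \<epsilon> *\<^sub>R id_blinfun)) C (at_right 0))"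


section \<open>Bochner integrals and the associated measure\<close>

text \<open>
  The predicate \<^const>\<open>has_bochner_integral\<close> of the library is restricted to second countable
  target spaces, which excludes \<open>B(H)\<close> for infinite-dimensional \<open>H\<close>. The following is its
  definition with Borel measurability replaced by strong measurability, i.e. the integrand is an
  almost everywhere pointwise limit of simple functions. One sequence can serve for both limits:
  a sequence converging in the integral norm has an almost everywhere convergent subsequence.
\<close>

definition has_strong_bochner_integral ::
    "'a measure \<Rightarrow> ('a \<Rightarrow> 'b::real_normed_vector) \<Rightarrow> 'b \<Rightarrow> bool"
  where "has_strong_bochner_integral M f x \<longleftrightarrow>
    (\<exists>s. (\<forall>i. Bochner_Integration.simple_bochner_integrable M (s i)) \<and>
         (AE y in M. (\<lambda>i. s i y) \<longlonglongrightarrow> f y) \<and>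
         (\<lambda>i. \<integral>\<^sup>+ y. ennreal (norm (f y - s i y)) \<partial>M) \<longlonglongrightarrow> 0 \<and>
         (\<lambda>i. Bochner_Integration.simple_bochner_integral M (s i)) \<longlonglongrightarrow> x)"

text \<open>
  For nonzero \<open>H\<close> at most one measure satisfies this, so it determines the associated measure
  of \<open>\<sigma>\<close>. For \<open>H = {0}\<close> every finite Borel measure on the unit interval satisfies it.
\<close>

definition associated_measure ::
    "(('h::complex_hilbert \<Rightarrow>\<^sub>L 'h) \<Rightarrow> ('h \<Rightarrow>\<^sub>L 'h) \<Rightarrow> ('h \<Rightarrow>\<^sub>L 'h)) \<Rightarrow> real measure \<Rightarrow> bool"
  where "associated_measure \<sigma> \<mu> \<longleftrightarrow>
    sets \<mu> = sets (restrict_space borel {0..1}) \<and> finite_measure \<mu> \<and>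
    (\<forall>A\<in>BHpos. \<forall>B\<in>BHpos.
      has_strong_bochner_integral \<mu> (\<lambda>t. harmonic_mean t A B) (\<sigma> A B))"

end

theory Submission
  imports Defs
begin

text \<open>
  Since \<open>I !\<^sub>t I = I\<close> for every \<open>t\<close>, the integral representation gives
  \<open>I \<sigma> I = \<mu>([0,1]) I\<close>, and \<open>I \<noteq> 0\<close> on a nonzero space.
\<close>

text \<open>Evaluates the definite description in \<open>op_inverse\<close>: any two-sided inverse
  \<open>C\<close> of \<open>A\<close> satisfies C = C(AB) = (CA)B = B, argued pointwise.\<close>

lemma op_inverse_unique:
  assumes "A o\<^sub>L B = id_blinfun" "B o\<^sub>L A = id_blinfun"
  shows "op_inverse A = B"
  unfolding op_inverse_def
proof (rule the_equality)
  fix C assume "A o\<^sub>L C = id_blinfun \<and> C o\<^sub>L A = id_blinfun"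
  then show "C = B"
    using assms by (intro blinfun_eqI) (metis blinfun_apply_blinfun_compose id_blinfun.rep_eq)
qed (use assms in simp)

lemma op_inverse_scaleR_id:
  assumes "r \<noteq> 0"
  shows "op_inverse (r *\<^sub>R id_blinfun :: 'h::complex_hilbert \<Rightarrow>\<^sub>L 'h) = inverse r *\<^sub>R id_blinfun"
  using assms by (intro op_inverse_unique blinfun_eqI) (simp_all add: blinfun.scaleR_left)

text \<open>The weights \<open>1 - t\<close> and \<open>t\<close> add up to 1 for every real
  \<open>t\<close>, so combining two equal inverses changes nothing, and the outer inversion undoes
  the inner one.\<close>

lemma harmonic_inv_scaleR_id:
  assumes "r \<noteq> 0"
  shows "harmonic_inv t (r *\<^sub>R id_blinfun) (r *\<^sub>R id_blinfun) =
    (r *\<^sub>R id_blinfun :: 'h::complex_hilbert \<Rightarrow>\<^sub>L 'h)"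
  using assms
  by (simp add: harmonic_inv_def op_inverse_scaleR_id flip: scaleR_left_distrib distrib_right)

lemma strong_limit_unique:
  assumes "strong_limit X A F" "strong_limit X B F" "F \<noteq> bot"
  shows "A = B"
  using assms unfolding strong_limit_def by (intro blinfun_eqI) (blast intro: tendsto_unique)

text \<open>The regularized means are \<open>(1 + \<epsilon>) *\<^sub>R id_blinfun\<close>, which
  tend to the identity; uniqueness of strong limits then evaluates the \<open>THE\<close>.\<close>

lemma harmonic_mean_id:
  "harmonic_mean t id_blinfun id_blinfun = (id_blinfun :: 'h::complex_hilbert \<Rightarrow>\<^sub>L 'h)"
proof -
  let ?X = "\<lambda>\<epsilon>::real. harmonic_inv t (id_blinfun + \<epsilon> *\<^sub>R id_blinfun)
    (id_blinfun + \<epsilon> *\<^sub>R id_blinfun :: 'h \<Rightarrow>\<^sub>L 'h)"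
  have X: "?X \<epsilon> = (1 + \<epsilon>) *\<^sub>R id_blinfun" if "\<epsilon> > 0" for \<epsilon>
    using harmonic_inv_scaleR_id[of "1 + \<epsilon>" t] that by (simp add: scaleR_left_distrib)
  have "strong_limit ?X id_blinfun (at_right 0)"
    unfolding strong_limit_def
  proof
    fix x :: 'h
    have "((\<lambda>\<epsilon>::real. (1 + \<epsilon>) *\<^sub>R x) \<longlongrightarrow> (1 + 0) *\<^sub>R x) (at_right 0)"
      by (intro tendsto_intros)
    \<comment> \<open>The closed form \<open>X\<close> is available for
      \<open>\<epsilon> > 0\<close>, which holds eventually in \<open>at_right 0\<close>.\<close>
    moreover have "\<forall>\<^sub>F \<epsilon> in at_right 0. (1 + \<epsilon>) *\<^sub>R x = blinfun_apply (?X \<epsilon>) x"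
      using eventually_at_right_less by eventually_elim (simp add: X blinfun.scaleR_left)
    ultimately show "((\<lambda>\<epsilon>. blinfun_apply (?X \<epsilon>) x) \<longlongrightarrow> blinfun_apply id_blinfun x) (at_right 0)"
      by (simp add: tendsto_cong)
  qed
  then show ?thesis
    unfolding harmonic_mean_def
    by (intro the_equality) (auto intro: strong_limit_unique)
qed

text \<open>The simple integral is a contraction for the L1 norm. Any approximating sequence
  converges to \<open>f\<close> in that norm, so its integrals converge to the integral of
  \<open>f\<close>, and limits are unique.\<close>

lemma has_strong_bochner_integral_simple:
  assumes "has_strong_bochner_integral M f x"
    and f: "Bochner_Integration.simple_bochner_integrable M f"
  shows "x = Bochner_Integration.simple_bochner_integral M f"
proof -
  let ?I = "Bochner_Integration.simple_bochner_integral M"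
  from assms(1) obtain s where
    s: "\<And>i. Bochner_Integration.simple_bochner_integrable M (s i)"
    and lim0: "(\<lambda>i. \<integral>\<^sup>+ y. ennreal (norm (f y - s i y)) \<partial>M) \<longlonglongrightarrow> 0"
    and lim: "(\<lambda>i. ?I (s i)) \<longlonglongrightarrow> x"
    unfolding has_strong_bochner_integral_def by blast
  have "ennreal (norm (?I f - ?I (s i))) \<le> (\<integral>\<^sup>+ y. ennreal (norm (f y - s i y)) \<partial>M)" for i
  proof -
    have "norm (?I f - ?I (s i)) = norm (?I (\<lambda>y. f y - s i y))"
      using f s by (simp add: simple_bochner_integral_diff)
    also have "\<dots> \<le> ?I (\<lambda>y. norm (f y - s i y))"
      using simple_bochner_integrable_compose2[of "(-)" M f "s i"] f s
      by (intro simple_bochner_integral_norm_bound) simp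
    finally have "ennreal (norm (?I f - ?I (s i))) \<le> ennreal (?I (\<lambda>y. norm (f y - s i y)))"
      by (rule ennreal_leI)
    \<comment> \<open>The pointwise norm of \<open>f - s i\<close> is a nonnegative real simple
      function, so both integrals agree on it.\<close>
    also have "\<dots> = (\<integral>\<^sup>+ y. ennreal (norm (f y - s i y)) \<partial>M)"
      using simple_bochner_integrable_compose2[of "\<lambda>x y. norm (x - y)" M f "s i"] f s
      by (intro simple_bochner_integral_eq_nn_integral) simp_all
    finally show ?thesis .
  qed
  \<comment> \<open>Writing the limit as \<open>ennreal 0\<close> allows the convergence to be
    transferred to the reals.\<close>
  then have "(\<lambda>i. ennreal (norm (?I f - ?I (s i)))) \<longlonglongrightarrow> ennreal 0"
    by (intro tendsto_sandwich[OF _ _ tendsto_const lim0[folded ennreal_0]]) simp_all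
  then have "(\<lambda>i. norm (?I f - ?I (s i))) \<longlonglongrightarrow> 0"
    by (subst (asm) tendsto_ennreal_iff) simp_all
  then have "(\<lambda>i. ?I f - ?I (s i)) \<longlonglongrightarrow> 0"
    by (rule tendsto_norm_zero_cancel)
  from tendsto_diff[OF tendsto_const[of "?I f"] this] have "(\<lambda>i. ?I (s i)) \<longlonglongrightarrow> ?I f"
    by simp
  with lim show ?thesis
    by (rule LIMSEQ_unique)
qed

text \<open>Finiteness of the measure makes a constant function simple and integrable, and its
  integral is a sum over the single value \<open>c\<close>.\<close>

lemma (in finite_measure) has_strong_bochner_integral_const:
  assumes "has_strong_bochner_integral M (\<lambda>_. c) x"
  shows "x = measure M (space M) *\<^sub>R c"
proof -
  have "Bochner_Integration.simple_bochner_integrable M (\<lambda>_. c)"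
    by (intro simple_bochner_integrable.intros) (simp_all add: emeasure_eq_measure)
  with assms have "x = Bochner_Integration.simple_bochner_integral M (\<lambda>_. c)"
    by (rule has_strong_bochner_integral_simple)
  then show ?thesis
    \<comment> \<open>On an empty space the range is empty rather than \<open>{c}\<close>; the sum
      and the total mass then both vanish.\<close>
    by (cases "space M = {}") (simp_all add: simple_bochner_integral_def image_constant_conv)
qed

lemma id_blinfun_in_BHpos: "(id_blinfun :: 'h::complex_hilbert \<Rightarrow>\<^sub>L 'h) \<in> BHpos"
  by (simp add: positive_operators_def bounded_operators_def cinner_self)

theorem corollary2p7:
  fixes \<sigma> :: "('h::complex_hilbert \<Rightarrow>\<^sub>L 'h) \<Rightarrow> ('h \<Rightarrow>\<^sub>L 'h) \<Rightarrow> ('h \<Rightarrow>\<^sub>L 'h)"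
    and \<mu> :: "real measure"
  assumes nonzero_space: "\<exists>x::'h. x \<noteq> 0"
    and "connection \<sigma>"
    and "associated_measure \<sigma> \<mu>"
  shows "mean \<sigma> \<longleftrightarrow> prob_space \<mu>"
proof -
  let ?I = "id_blinfun :: 'h \<Rightarrow>\<^sub>L 'h"
  interpret finite_measure \<mu>
    using assms(3) by (simp add: associated_measure_def)
  have "has_strong_bochner_integral \<mu> (\<lambda>t. harmonic_mean t ?I ?I) (\<sigma> ?I ?I)"
    using assms(3) id_blinfun_in_BHpos by (auto simp: associated_measure_def)
  then have "\<sigma> ?I ?I = measure \<mu> (space \<mu>) *\<^sub>R ?I"
    by (intro has_strong_bochner_integral_const) (simp add: harmonic_mean_id)
  \<comment> \<open>A nonzero vector is moved by the identity to a nonzero vector. This permits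
    cancelling \<open>?I\<close>, so that the total mass can be read off from \<sigma>'s value at
    the identity.\<close>
  moreover have "?I \<noteq> 0"
    using nonzero_space by (metis blinfun_apply_id_blinfun id_apply zero_blinfun.rep_eq)
  ultimately have "mean \<sigma> \<longleftrightarrow> measure \<mu> (space \<mu>) = 1"
    using \<open>connection \<sigma>\<close> scaleR_right_imp_eq[of ?I "measure \<mu> (space \<mu>)" 1]
    by (auto simp: mean_def)
  also have "\<dots> \<longleftrightarrow> prob_space \<mu>"
    using prob_space.prob_space[of \<mu>] by (auto intro!: prob_spaceI simp: emeasure_eq_measure)
  finally show ?thesis .
qed

end
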